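(* Let $G$ be a finite group, let $H\le G$ be an abelian subgroup, and let $A$ be a multiset of cardinality $|G|$ all of whose elements lie in $H$. Then $A$ is quotient-realizable in $G$ if and only if $A$ can be partitioned, as a multiset, into $[G:H]$ submultisets $A_1,\ldots,A_{[G:H]}$ with $|A_j|=|H|$ for every $j$, such that $\prod_{a\in A_j}a=1$ for every $j$.
   Context: All multisets are counted with multiplicity, and products over multisets are taken with multiplicity; groups are written multiplicatively. A multiset $A$ of cardinality $|G|$ with elements in a finite group $G$ is quotient-realizable in $G$ if there exist bijections $b,c:\{1,\ldots,|G|\}\to G$ such that $A=\{b(i)c(i)^{-1}:1\le i\le |G|\}$ as multisets. A partition of a multiset into submultisets means that it is their multiset sum (multiplicities add). *)

theory Defs
  imports "HOL-Algebra.Algebra" "HOL-Library.Multiset"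
begin

text \<open>The conditions \<open>size A = order G\<close> and \<open>set_mset A \<subseteq> carrier G\<close> under which the notion is
  considered follow from the equation below, so they are not repeated.\<close>

definition quotient_realizable :: "('a, 'b) monoid_scheme \<Rightarrow> 'a multiset \<Rightarrow> bool" where
  "quotient_realizable G A \<longleftrightarrow>
     (\<exists>b c :: nat \<Rightarrow> 'a.
        bij_betw b {1..order G} (carrier G) \<and>
        bij_betw c {1..order G} (carrier G) \<and>
        A = image_mset (\<lambda>i. b i \<otimes>\<^bsub>G\<^esub> inv\<^bsub>G\<^esub> (c i)) (mset_set {1..order G}))"

text \<open>Product of a multiset with multiplicity in a commutative monoid \<open>K\<close>. It is meaningful only
  if \<open>K\<close> is commutative and all elements of \<open>M\<close> lie in \<open>carrier K\<close>; for an abelian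
  subgroup \<open>H\<close> of a group \<open>G\<close> it has to be used with \<open>K = G\<lparr>carrier := H\<rparr>\<close>, because \<open>G\<close> itself
  need not be commutative.\<close>

definition finprod_mset :: "('a, 'b) monoid_scheme \<Rightarrow> 'a multiset \<Rightarrow> 'a" where
  "finprod_mset K M = finprod K (\<lambda>a. a [^]\<^bsub>K\<^esub> count M a) (set_mset M)"

lemma (in comm_monoid) finprod_mset_empty [simp]: "finprod_mset G {#} = \<one>"
  by (simp add: finprod_mset_def)

lemma (in comm_monoid) finprod_mset_add_mset:
  assumes "x \<in> carrier G" "set_mset M \<subseteq> carrier G"
  shows "finprod_mset G (add_mset x M) = x \<otimes> finprod_mset G M"
proof -
  let ?S = "insert x (set_mset M)"
  let ?f = "\<lambda>a. a [^] count M a" and ?g = "\<lambda>a. if x = a then a else \<one>"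
  have S: "?S \<subseteq> carrier G" "finite ?S" using assms by auto
  have "finprod_mset G (add_mset x M) = finprod G (\<lambda>a. ?g a \<otimes> ?f a) ?S"
    unfolding finprod_mset_def set_mset_add_mset_insert
  proof (rule finprod_cong')
    show "(\<lambda>a. ?g a \<otimes> ?f a) \<in> ?S \<rightarrow> carrier G" using S by auto
    fix a assume "a \<in> ?S"
    then have "a \<in> carrier G" using S by auto
    then show "a [^] count (add_mset x M) a = ?g a \<otimes> ?f a"
      by (auto simp: m_comm)
  qed simp
  also have "\<dots> = finprod G ?g ?S \<otimes> finprod G ?f ?S"
    by (rule finprod_multf) (use S in auto)
  also have "finprod G ?g ?S = x"
    using finprod_singleton[of x ?S "\<lambda>a. a"] S by auto
  also have "finprod G ?f ?S = finprod G ?f (set_mset M)"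
    by (rule finprod_mono_neutral_cong_right) (use S in \<open>auto simp: not_in_iff\<close>)
  finally show ?thesis by (simp add: finprod_mset_def)
qed

end

theory Submission
  imports Defs
begin

text \<open>A quotient \<open>b c\<inverse>\<close> lies in \<open>H\<close> iff \<open>b\<close> and \<open>c\<close> lie in the same right coset of \<open>H\<close>. So a
  realization of \<open>A\<close> splits into one realization per coset, and translating a coset to \<open>H\<close>
  does not change quotients. The theorem thus reduces to M. Hall's theorem that in a finite
  abelian group \<open>H\<close> exactly the multisets of size \<open>|H|\<close> and product \<open>1\<close> are realizable, which
  follows by repeatedly exchanging two quotients for two others with the same product.
  Bijections \<open>b, c\<close> are encoded as the multiset of pairs \<open>(b i, c i)\<close>.\<close>

section \<open>Matchings and realizability\<close>

text \<open>For finite \<open>S\<close> such an \<open>M\<close> is the graph of a permutation of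
  \<open>S\<close>. Having no indices, matchings can simply be added, filtered and mapped.\<close>

definition matching :: "'a set \<Rightarrow> ('a \<times> 'a) multiset \<Rightarrow> bool" where
  "matching S M \<longleftrightarrow> image_mset fst M = mset_set S \<and> image_mset snd M = mset_set S"

definition quotients :: "('a, 'b) monoid_scheme \<Rightarrow> ('a \<times> 'a) multiset \<Rightarrow> 'a multiset" where
  "quotients G M = image_mset (\<lambda>z. fst z \<otimes>\<^bsub>G\<^esub> inv\<^bsub>G\<^esub> (snd z)) M"

lemma quotients_simps [simp]:
  "quotients G {#} = {#}"
  "quotients G (add_mset z M) = add_mset (fst z \<otimes>\<^bsub>G\<^esub> inv\<^bsub>G\<^esub> (snd z)) (quotients G M)"
  "quotients G (M + N) = quotients G M + quotients G N"
  by (simp_all add: quotients_def)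

lemma size_quotients [simp]: "size (quotients G M) = size M"
  by (simp add: quotients_def)

lemma matchingD:
  assumes "matching S M" "finite S"
  shows "size M = card S" and "z \<in># M \<Longrightarrow> fst z \<in> S" and "z \<in># M \<Longrightarrow> snd z \<in> S"
proof -
  show "size M = card S"
    using assms by (metis matching_def size_image_mset size_mset_set)
  have "fst ` set_mset M = S" "snd ` set_mset M = S"
    using assms unfolding matching_def by (metis finite_set_mset_mset_set set_image_mset)+
  then show "z \<in># M \<Longrightarrow> fst z \<in> S" "z \<in># M \<Longrightarrow> snd z \<in> S" by blast+
qed

lemma quotient_realizable_iff_matching:
  assumes "finite (carrier G)"
  shows "quotient_realizable G A \<longleftrightarrow> (\<exists>M. matching (carrier G) M \<and> A = quotients G M)"
proof
  assume "quotient_realizable G A"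
  then obtain b c :: "nat \<Rightarrow> 'a" where
    bc: "bij_betw b {1..order G} (carrier G)" "bij_betw c {1..order G} (carrier G)"
    and A: "A = image_mset (\<lambda>i. b i \<otimes>\<^bsub>G\<^esub> inv\<^bsub>G\<^esub> (c i)) (mset_set {1..order G})"
    unfolding quotient_realizable_def by blast
  let ?M = "image_mset (\<lambda>i. (b i, c i)) (mset_set {1..order G})"
  have "matching (carrier G) ?M"
    using bc by (simp add: matching_def image_mset.compositionality comp_def image_mset_mset_set bij_betw_def)
  moreover have "A = quotients G ?M"
    by (simp add: A quotients_def image_mset.compositionality comp_def)
  ultimately show "\<exists>M. matching (carrier G) M \<and> A = quotients G M" by blast
next
  assume "\<exists>M. matching (carrier G) M \<and> A = quotients G M"
  then obtain M where M: "matching (carrier G) M" "A = quotients G M" by blast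
  \<comment> \<open>Any listing of the pairs provides the indices. The bijections are indexed from 1
    and list positions from 0, hence \<open>i - 1\<close> below.\<close>
  obtain xs where xs: "mset xs = M" using ex_mset by blast
  have len: "length xs = order G"
    using matchingD(1)[OF M(1) assms] xs by (metis order_def size_mset)
  have upt: "mset_set {1..order G} = mset [1..<Suc (length xs)]"
    unfolding mset_upt len by (simp add: atLeastLessThanSuc_atLeastAtMost)
  have shift: "map (\<lambda>i. f (xs ! (i - 1))) [1..<Suc (length xs)] = map f xs" for f :: "'a \<times> 'a \<Rightarrow> 'a"
    by (rule nth_equalityI) (auto simp del: upt_Suc)
  have img: "image_mset (\<lambda>i. f (xs ! (i - 1))) (mset_set {1..order G}) = image_mset f M" for f :: "'a \<times> 'a \<Rightarrow> 'a"
    using shift[of f] by (metis upt xs mset_map)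
  have bij: "bij_betw (\<lambda>i. f (xs ! (i - 1))) {1..order G} (carrier G)"
    if "image_mset f M = mset_set (carrier G)" for f
  proof -
    have "image_mset (\<lambda>i. f (xs ! (i - 1))) (mset_set {1..order G}) = mset_set (carrier G)"
      using img that by simp
    then have "set_mset (image_mset (\<lambda>i. f (xs ! (i - 1))) (mset_set {1..order G})) = carrier G"
      using assms by simp
    then have im: "(\<lambda>i. f (xs ! (i - 1))) ` {1..order G} = carrier G" by simp
    moreover have "inj_on (\<lambda>i. f (xs ! (i - 1))) {1..order G}"
      by (rule eq_card_imp_inj_on) (simp, simp only: im, simp add: order_def)
    ultimately show ?thesis by (simp add: bij_betw_def)
  qed
  show "quotient_realizable G A"
    unfolding quotient_realizable_def
  proof (intro exI conjI)
    show "bij_betw (\<lambda>i. fst (xs ! (i - 1))) {1..order G} (carrier G)"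
      "bij_betw (\<lambda>i. snd (xs ! (i - 1))) {1..order G} (carrier G)"
      by (rule bij, use M(1) in \<open>simp add: matching_def\<close>)+
    show "A = image_mset (\<lambda>i. fst (xs ! (i - 1)) \<otimes>\<^bsub>G\<^esub> inv\<^bsub>G\<^esub> (snd (xs ! (i - 1)))) (mset_set {1..order G})"
      using img[of "\<lambda>z. fst z \<otimes>\<^bsub>G\<^esub> inv\<^bsub>G\<^esub> (snd z)"] by (simp add: M(2) quotients_def)
  qed
qed

section \<open>Hall's theorem for finite abelian groups\<close>

lemma (in comm_monoid) finprod_mset_closed:
  "set_mset M \<subseteq> carrier G \<Longrightarrow> finprod_mset G M \<in> carrier G"
  by (induction M) (simp_all add: finprod_mset_add_mset)

lemma (in comm_group) finprod_mset_quotients: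
  assumes "\<And>z. z \<in># M \<Longrightarrow> fst z \<in> carrier G \<and> snd z \<in> carrier G"
  shows "finprod_mset G (quotients G M) =
    finprod_mset G (image_mset fst M) \<otimes> inv (finprod_mset G (image_mset snd M))"
  using assms
proof (induction M)
  case empty
  then show ?case by simp
next
  case (add z M)
  have "a \<in> carrier G \<and> b \<in> carrier G" if "(a, b) \<in># M" for a b
    using add.prems[of "(a, b)"] that by simp
  then have c: "finprod_mset G (image_mset fst M) \<in> carrier G" "finprod_mset G (image_mset snd M) \<in> carrier G"
    "fst z \<in> carrier G" "snd z \<in> carrier G" "set_mset (quotients G M) \<subseteq> carrier G"
    "set_mset (image_mset fst M) \<subseteq> carrier G" "set_mset (image_mset snd M) \<subseteq> carrier G"
    using add.prems[of z] by (auto intro!: finprod_mset_closed simp: quotients_def)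
  show ?case
    using add.IH add.prems c by (simp add: finprod_mset_add_mset inv_mult m_ac)
qed

text \<open>By commutativity the product splits into numerators over denominators, and both are the
  product of all group elements. Besides giving necessity, this later identifies the correction term
  in \<open>hall_matching\<close>.\<close>

lemma (in comm_group) finprod_mset_quotients_matching:
  assumes "finite (carrier G)" "matching (carrier G) M"
  shows "finprod_mset G (quotients G M) = \<one>"
proof -
  have "finprod_mset G (mset_set (carrier G)) \<in> carrier G"
    using assms by (intro finprod_mset_closed) simp
  then show ?thesis
    using matchingD(2,3)[OF assms(2,1)] finprod_mset_quotients[of M] assms(2)
    by (simp add: matching_def)
qed

text \<open>\<open>R\<close> is the part of the matching not yet modified and \<open>D\<close> the modified part; \<open>x, y\<close> and
  \<open>r, s\<close> are the unmatched elements on either side. The pair starting at \<open>x\<close> must have quotient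
  \<open>x y S\<inverse>\<close>, which forces the partner \<open>S y\<inverse>\<close>; if this is taken by some \<open>y'\<close>, that pair is dissolved
  and the next quotient needed is \<open>y y' S\<inverse>\<close>. The last hypothesis says that the partners used
  up so far are the reflections \<open>S w\<inverse>\<close> of the earlier values \<open>w\<close> of \<open>y\<close>, so none is used twice;
  \<open>p\<close> is the initial value of \<open>x\<close>.\<close>

lemma (in comm_group) matching_exchange_aux:
  assumes fin: "finite (carrier G)"
    and "image_mset fst (D + R) + {#x, y#} = mset_set (carrier G)"
    and "image_mset snd (D + R) + {#r, s#} = mset_set (carrier G)"
    and "p \<in> carrier G" "u \<in> carrier G" "S = r \<otimes> s \<otimes> u"
    and "image_mset (\<lambda>w. S \<otimes> inv w) (image_mset fst D + {#x#}) = image_mset snd D + {#S \<otimes> inv p#}"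
  shows "\<exists>M. matching (carrier G) M \<and>
    quotients G M = quotients G (D + R) + {#x \<otimes> y \<otimes> inv S, u#}"
  using assms(2-)
proof (induction "size R" arbitrary: D R x y rule: less_induct)
  case less
  note f = less.prems(1) and sn = less.prems(2) and p = less.prems(3) and u = less.prems(4)
    and S = less.prems(5) and refl = less.prems(6)
  have mem_f: "w \<in># image_mset fst (D + R) + {#x, y#} \<longleftrightarrow> w \<in> carrier G" for w
    unfolding f using fin by simp
  have mem_s: "w \<in># image_mset snd (D + R) + {#r, s#} \<longleftrightarrow> w \<in> carrier G" for w
    unfolding sn using fin by simp
  have c: "x \<in> carrier G" "y \<in> carrier G" "r \<in> carrier G" "s \<in> carrier G"
    using mem_f[of x] mem_f[of y] mem_s[of r] mem_s[of s] by auto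
  have cS: "S \<in> carrier G" using c u S by simp
  define c' where "c' = S \<otimes> inv y"
  have c': "c' \<in> carrier G" using c cS by (simp add: c'_def)
  have q: "w \<otimes> inv c' = w \<otimes> y \<otimes> inv S" if "w \<in> carrier G" for w
    using that c cS by (simp add: c'_def inv_mult m_ac)
  have y: "y = S \<otimes> inv c'" using c cS by (simp add: c'_def inv_mult m_assoc[symmetric])
  have u': "S \<otimes> inv (r \<otimes> s) = u"
    using c u m_assoc[of u "r \<otimes> s" "inv (r \<otimes> s)"] by (simp add: S m_comm[of "r \<otimes> s" u])
  consider "c' = r" | "c' = s" | "c' \<in># image_mset snd D" | "c' \<in># image_mset snd R"
    using mem_s[of c'] c' by auto
  then show ?case
  proof cases
    case 1
    \<comment> \<open>The chain closes: r = S y^-1 with S = r s u gives y = s u, so the leftover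
      pair \<open>(y, s)\<close> has quotient \<open>u\<close>. The next case is the same with
      \<open>r\<close> and \<open>s\<close> interchanged.\<close>
    let ?M = "D + R + {#(x, r), (y, s)#}"
    have "matching (carrier G) ?M"
      using f sn by (simp add: matching_def add_mset_commute)
    moreover have "y \<otimes> inv s = u"
      using c u u' cS unfolding y 1 by (simp add: inv_mult m_ac)
    ultimately show ?thesis
      using q[of x] c 1 by (intro exI[of _ ?M]) (simp add: add_mset_commute)
  next
    case 2
    let ?M = "D + R + {#(x, s), (y, r)#}"
    have "matching (carrier G) ?M"
      using f sn by (simp add: matching_def add_mset_commute)
    moreover have "y \<otimes> inv r = u"
      using c u u' cS unfolding y 2 by (simp add: inv_mult m_ac)
    ultimately show ?thesis
      using q[of x] c 2 by (intro exI[of _ ?M]) (simp add: add_mset_commute)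
  next
    case 3
    \<comment> \<open>Impossible: \<open>refl\<close> makes \<open>c'\<close> the reflection of
      \<open>x\<close> or of a first component in \<open>D\<close>. Reflection is injective, so that
      element is \<open>y\<close>, which would then occur twice among the first components.\<close>
    then have "c' \<in># image_mset (\<lambda>w. S \<otimes> inv w) (image_mset fst D + {#x#})"
      unfolding refl by simp
    then obtain w where w: "w \<in># image_mset fst D + {#x#}" "c' = S \<otimes> inv w"
      by (auto simp del: image_mset_union)
    then have "w \<in> carrier G" using mem_f[of w] by auto
    then have "w = y" using w(2) c cS inv_inj by (simp add: c'_def inj_onD)
    then obtain E where E: "image_mset fst D + {#x#} = add_mset y E"
      using w(1) by (metis mset_add)
    have "image_mset fst (D + R) + {#x, y#} = (image_mset fst D + {#x#}) + image_mset fst R + {#y#}"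
      by simp
    also have "\<dots> = add_mset y (add_mset y (E + image_mset fst R))"
      unfolding E by simp
    finally have "count (mset_set (carrier G)) y \<ge> 2"
      unfolding f by simp
    moreover have "count (mset_set (carrier G)) y \<le> 1"
      by (simp add: count_mset_set')
    ultimately show ?thesis by simp
  next
    case 4
    then obtain z where "z \<in># R" and z: "snd z = c'" by auto
    then obtain R' where R: "R = add_mset z R'" by (metis mset_add)
    have fz: "fst z \<in> carrier G" using mem_f[of "fst z"] by (simp add: R)
    \<comment> \<open>Dissolve \<open>z\<close> and add \<open>(x, c')\<close> to \<open>D\<close>;
      now \<open>y\<close> and \<open>fst z\<close> are unmatched. The next target y (fst z) S^-1
      is, by \<open>q\<close>, exactly the quotient lost with \<open>z\<close>, while
      \<open>(x, c')\<close> supplies x y S^-1.\<close>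
    have "\<exists>M. matching (carrier G) M \<and>
      quotients G M = quotients G (add_mset (x, c') D + R') + {#y \<otimes> fst z \<otimes> inv S, u#}"
    proof (rule less.hyps)
      show "size R' < size R" by (simp add: R)
      show "image_mset fst (add_mset (x, c') D + R') + {#y, fst z#} = mset_set (carrier G)"
        using f by (simp add: R add_mset_commute)
      show "image_mset snd (add_mset (x, c') D + R') + {#r, s#} = mset_set (carrier G)"
        using sn by (simp add: R z add_mset_commute)
      show "image_mset (\<lambda>w. S \<otimes> inv w) (image_mset fst (add_mset (x, c') D) + {#y#}) =
        image_mset snd (add_mset (x, c') D) + {#S \<otimes> inv p#}"
        using refl by (simp add: c'_def add_mset_commute)
    qed (use p u S in simp_all)
    then show ?thesis
      using q[of x] q[of "fst z"] c fz by (simp add: R z add_mset_commute m_comm)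
  qed
qed

text \<open>The pairs with quotients \<open>d\<close> and \<open>e\<close> are dissolved, and the
  chain of \<open>matching_exchange_aux\<close> starts from their components with no modified
  pairs.\<close>

lemma (in comm_group) matching_exchange:
  assumes fin: "finite (carrier G)" and M: "matching (carrier G) M"
    and q: "quotients G M = add_mset d (add_mset e B)"
    and tu: "t \<in> carrier G" "u \<in> carrier G" "t \<otimes> u = d \<otimes> e"
  shows "\<exists>M'. matching (carrier G) M' \<and> quotients G M' = add_mset t (add_mset u B)"
proof -
  obtain z M1 where z: "M = add_mset z M1" "d = fst z \<otimes> inv (snd z)" "add_mset e B = quotients G M1"
    using msed_map_invR[OF q[unfolded quotients_def]] by (auto simp: quotients_def)
  obtain z' R where z': "M1 = add_mset z' R" "e = fst z' \<otimes> inv (snd z')" "B = quotients G R"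
    using msed_map_invR[OF z(3)[symmetric, unfolded quotients_def]] by (auto simp: quotients_def)
  have c: "fst z \<in> carrier G" "snd z \<in> carrier G" "fst z' \<in> carrier G" "snd z' \<in> carrier G"
    using matchingD(2,3)[OF M fin] by (simp_all add: z(1) z'(1))
  \<comment> \<open>With this choice the first new quotient, x y S^-1, becomes d e u^-1 = t.\<close>
  let ?S = "snd z \<otimes> snd z' \<otimes> u"
  have "\<exists>M. matching (carrier G) M \<and>
    quotients G M = quotients G ({#} + R) + {#fst z \<otimes> fst z' \<otimes> inv ?S, u#}"
  proof (rule matching_exchange_aux[OF fin])
    show "image_mset fst ({#} + R) + {#fst z, fst z'#} = mset_set (carrier G)"
      "image_mset snd ({#} + R) + {#snd z, snd z'#} = mset_set (carrier G)"
      using M by (simp_all add: matching_def z(1) z'(1) add_mset_commute)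
  qed (use c tu in \<open>auto\<close>)
  moreover have "fst z \<otimes> fst z' \<otimes> inv ?S = t"
  proof -
    have "fst z \<otimes> fst z' \<otimes> inv ?S = (d \<otimes> e) \<otimes> inv u"
      using c tu(1,2) by (simp add: z(2) z'(2) inv_mult m_ac)
    also have "\<dots> = t" using tu(1,2) by (simp add: tu(3)[symmetric] m_assoc)
    finally show ?thesis .
  qed
  ultimately show ?thesis by (simp add: z'(3))
qed

text \<open>Starting from the all-ones multiset, the prescribed quotients are installed one at a time at
  the expense of a single correction term \<open>v\<close>.\<close>

lemma (in comm_group) hall_matching:
  assumes fin: "finite (carrier G)" and A: "set_mset A \<subseteq> carrier G"
    and size: "size A = order G" and prod: "finprod_mset G A = \<one>"
  shows "\<exists>M. matching (carrier G) M \<and> quotients G M = A"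
proof -
  \<comment> \<open>One slot is reserved for \<open>v\<close>, hence the \<open>- 1\<close>; the
    bound on \<open>size B\<close> keeps the truncated subtraction exact.\<close>
  have partial: "\<exists>M v. matching (carrier G) M \<and>
      quotients G M = add_mset v (B + replicate_mset (order G - 1 - size B) \<one>)"
    if "size B < order G" "set_mset B \<subseteq> carrier G" for B
    using that
  proof (induction B)
    case empty
    \<comment> \<open>The identity permutation has all quotients equal to 1.\<close>
    let ?M = "image_mset (\<lambda>h. (h, h)) (mset_set (carrier G))"
    have "quotients G ?M = image_mset (\<lambda>h. \<one>) (mset_set (carrier G))"
      unfolding quotients_def image_mset.compositionality comp_def
      by (rule image_mset_cong) (use fin in simp)
    also have "\<dots> = add_mset \<one> (replicate_mset (order G - 1) \<one>)"
      using empty by (cases "order G") (simp_all add: image_mset_const_eq order_def)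
    finally show ?case
      by (intro exI[of _ ?M] exI[of _ \<one>])
        (simp add: matching_def image_mset.compositionality comp_def)
  next
    case (add b B)
    then obtain M v where M: "matching (carrier G) M"
      and q: "quotients G M = add_mset v (B + replicate_mset (order G - 1 - size B) \<one>)"
      by auto
    obtain k where k: "order G - 1 - size B = Suc k" "order G - 1 - size (add_mset b B) = k"
      using add.prems by (cases "order G - 1 - size B") auto
    have "v \<in># quotients G M" by (simp add: q)
    then have v: "v \<in> carrier G"
      using matchingD(2,3)[OF M fin] by (auto simp: quotients_def)
    \<comment> \<open>One of the remaining ones is spent: v and 1 are exchanged for b and v b^-1, so
      v b^-1 is the new correction term.\<close>
    have "\<exists>M. matching (carrier G) M \<and>
      quotients G M = add_mset b (add_mset (v \<otimes> inv b) (B + replicate_mset k \<one>))"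
    proof (rule matching_exchange[OF fin M])
      show "quotients G M = add_mset v (add_mset \<one> (B + replicate_mset k \<one>))"
        using k(1) by (simp add: q)
    qed (use v add.prems in \<open>auto simp: m_comm[of v] m_assoc[symmetric]\<close>)
    then show ?case unfolding k by (auto simp: add_mset_commute)
  qed
  have "order G > 0" using fin order_gt_0_iff_finite by simp
  then obtain a B where AB: "A = add_mset a B" using size by (metis multiset_cases size_empty less_irrefl)
  then obtain M v where M: "matching (carrier G) M" and q: "quotients G M = add_mset v B"
    using partial[of B] size A by auto
  have "v \<in># quotients G M" by (simp add: q)
  then have v: "v \<in> carrier G"
    using matchingD(2,3)[OF M fin] by (auto simp: quotients_def)
  have a: "a \<in> carrier G" and B: "set_mset B \<subseteq> carrier G" using A AB by auto
  have "v \<otimes> finprod_mset G B = a \<otimes> finprod_mset G B"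
    using finprod_mset_quotients_matching[OF fin M] prod v a B
    by (simp add: q AB finprod_mset_add_mset)
  then have "v = a" using v a finprod_mset_closed[OF B] by simp
  then show ?thesis using M q AB by auto
qed

section \<open>Cutting and gluing matchings along right cosets\<close>

lemma sum_mset_set_disjoint:
  assumes "finite F" "\<And>C. C \<in> F \<Longrightarrow> finite C" "disjoint F"
  shows "(\<Sum>C\<in>F. mset_set C) = mset_set (\<Union>F)"
  using assms
proof (induction F rule: finite_induct)
  case (insert C F)
  then have "C \<inter> \<Union>F = {}" "disjoint F" by (auto simp: disjoint_def)
  then show ?case using insert by (simp add: mset_set_Union)
qed simp

lemma image_mset_sum: "image_mset f (\<Sum>i\<in>I. P i) = (\<Sum>i\<in>I. image_mset f (P i))"
  by (induction I rule: infinite_finite_induct) auto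

text \<open>In (x g)(y g)^-1 the factor g cancels. This carries matchings between \<open>H\<close>
  and its right cosets.\<close>

lemma quotients_translate:
  fixes G (structure)
  assumes "group G" "subgroup H G" "g \<in> carrier G"
    and "\<And>z. z \<in># M \<Longrightarrow> fst z \<in> H \<and> snd z \<in> H"
  shows "quotients G (image_mset (map_prod (\<lambda>x. x \<otimes>\<^bsub>G\<^esub> g) (\<lambda>x. x \<otimes>\<^bsub>G\<^esub> g)) M) =
    quotients (G\<lparr>carrier := H\<rparr>) M"
proof -
  interpret group G by fact
  have H: "H \<subseteq> carrier G" using assms(2) by (rule subgroup.subset)
  show ?thesis
    unfolding quotients_def image_mset.compositionality comp_def
  proof (rule image_mset_cong)
    fix z assume z: "z \<in># M"
    then have "fst z \<in> carrier G" "snd z \<in> carrier G" "snd z \<in> H" using assms(4) H by blast+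
    moreover from this have "g \<otimes> (inv g \<otimes> inv (snd z)) = inv (snd z)"
      using assms(3) by (simp add: m_assoc[symmetric])
    ultimately show "fst (map_prod (\<lambda>x. x \<otimes> g) (\<lambda>x. x \<otimes> g) z) \<otimes> inv (snd (map_prod (\<lambda>x. x \<otimes> g) (\<lambda>x. x \<otimes> g) z)) =
      fst z \<otimes>\<^bsub>G\<lparr>carrier := H\<rparr>\<^esub> inv\<^bsub>G\<lparr>carrier := H\<rparr>\<^esub> (snd z)"
      using assms(2,3) by (simp add: inv_mult_group m_assoc m_inv_consistent)
  qed
qed

lemma matching_map:
  assumes "matching S M" "inj_on f S"
  shows "matching (f ` S) (image_mset (map_prod f f) M)"
proof -
  have "image_mset fst (image_mset (map_prod f f) M) = image_mset f (image_mset fst M)"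
    "image_mset snd (image_mset (map_prod f f) M) = image_mset f (image_mset snd M)"
    by (simp_all add: image_mset.compositionality comp_def)
  then show ?thesis
    using assms by (simp add: matching_def image_mset_mset_set)
qed

text \<open>Since \<open>M\<close> respects \<open>T\<close>, selecting pairs by the first or by the
  second component gives the same submultiset, so both projections restrict to
  \<open>T\<close>.\<close>

lemma matching_filter:
  assumes "matching S M" "finite S" "T \<subseteq> S" "\<And>z. z \<in># M \<Longrightarrow> fst z \<in> T \<longleftrightarrow> snd z \<in> T"
  shows "matching T {#z \<in># M. fst z \<in> T#}"
proof -
  have "{#x \<in># mset_set S. x \<in> T#} = mset_set T"
    using assms(2,3) by (simp add: filter_mset_mset_set Int_absorb1 Collect_conj_eq Int_commute)
  moreover have "image_mset fst {#z \<in># M. fst z \<in> T#} = {#x \<in># image_mset fst M. x \<in> T#}"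
    by (simp add: filter_mset_image_mset)
  moreover have "{#z \<in># M. fst z \<in> T#} = {#z \<in># M. snd z \<in> T#}"
    using assms(4) by (rule filter_mset_cong0)
  moreover have "image_mset snd {#z \<in># M. snd z \<in> T#} = {#x \<in># image_mset snd M. x \<in> T#}"
    by (simp add: filter_mset_image_mset)
  ultimately show ?thesis using assms(1) by (simp add: matching_def)
qed

text \<open>Each \<open>f z\<close> lies in exactly one block, so exactly one summand contributes
  the multiplicity of \<open>z\<close>.\<close>

lemma sum_filter_mset:
  assumes "finite F" "disjoint F" "\<And>z. z \<in># M \<Longrightarrow> f z \<in> \<Union>F"
  shows "(\<Sum>C\<in>F. {#z \<in># M. f z \<in> C#}) = M"
proof (rule multiset_eqI)
  fix z
  show "count (\<Sum>C\<in>F. {#z \<in># M. f z \<in> C#}) z = count M z"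
  proof (cases "z \<in># M")
    case True
    then obtain C where C: "C \<in> F" "f z \<in> C" using assms(3) by blast
    then have "f z \<in> D \<longleftrightarrow> D = C" if "D \<in> F" for D
      using that assms(2) by (auto simp: disjoint_def)
    then have "count (\<Sum>C\<in>F. {#z \<in># M. f z \<in> C#}) z = (\<Sum>D\<in>F. if D = C then count M z else 0)"
      by (simp add: count_sum)
    then show ?thesis using C assms(1) by simp
  qed (simp add: count_sum not_in_iff cong: if_cong)
qed

lemma quotients_sum: "quotients G (\<Sum>i\<in>I. P i) = (\<Sum>i\<in>I. quotients G (P i))"
  by (simp add: quotients_def image_mset_sum)

theorem corollary4p2:
  fixes G :: "('a, 'b) monoid_scheme" and H :: "'a set" and A :: "'a multiset"
  assumes "group G" and "finite (carrier G)"
    and "subgroup H G" and "comm_group (G\<lparr>carrier := H\<rparr>)"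
    and "size A = order G" and "set_mset A \<subseteq> H"
  shows "quotient_realizable G A \<longleftrightarrow>
    (\<exists>P :: nat \<Rightarrow> 'a multiset.
       A = (\<Sum>j\<in>{1..card (rcosets\<^bsub>G\<^esub> H)}. P j) \<and>
       (\<forall>j\<in>{1..card (rcosets\<^bsub>G\<^esub> H)}.
          size (P j) = card H \<and> finprod_mset (G\<lparr>carrier := H\<rparr>) (P j) = \<one>\<^bsub>G\<^esub>))"
proof -
  interpret group G by fact
  interpret K: comm_group "G\<lparr>carrier := H\<rparr>" by fact
  let ?K = "G\<lparr>carrier := H\<rparr>" and ?F = "rcosets\<^bsub>G\<^esub> H"
  have H: "H \<subseteq> carrier G" using assms(3) by (rule subgroup.subset)
  have finH: "finite H" using H assms(2) by (rule finite_subset)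
  have F: "\<Union>?F = carrier G" "finite ?F" "disjoint ?F"
    using assms(2) rcosets_part_G[OF assms(3)] finite_UnionD[of ?F] rcos_disjoint[OF assms(3)]
    by (simp_all add: disjoint_def pairwise_def disjnt_def)
  have finC: "finite C" if "C \<in> ?F" for C
    using that F(1) assms(2) by (metis Union_upper finite_subset)
  \<comment> \<open>The numbering \<open>e\<close> ties the submultiset \<open>P j\<close> to the
    coset \<open>e j\<close>.\<close>
  obtain e where e: "bij_betw e {1..card ?F} ?F"
    using F(2) ex_bij_betw_nat_finite_1 by blast
  have inj: "inj_on (\<lambda>x. x \<otimes>\<^bsub>G\<^esub> g) H" if "g \<in> carrier G" for g
    using that right_cancel[of g] H by (meson inj_onI subsetD)
  have coset: "H #>\<^bsub>G\<^esub> g = (\<lambda>x. x \<otimes>\<^bsub>G\<^esub> g) ` H" for g by (auto simp: r_coset_def)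
  have rep: "\<exists>g. g \<in> carrier G \<and> C = (\<lambda>x. x \<otimes>\<^bsub>G\<^esub> g) ` H" if "C \<in> ?F" for C
    using that by (auto simp: RCOSETS_def coset)
  show ?thesis
  proof
    assume "quotient_realizable G A"
    then obtain M where M: "matching (carrier G) M" and A: "A = quotients G M"
      using quotient_realizable_iff_matching[OF assms(2)] by blast
    note carr = matchingD(2,3)[OF M assms(2)]
    define N where "N C = {#z \<in># M. fst z \<in> C#}" for C
    have same: "fst z \<in> C \<longleftrightarrow> snd z \<in> C" if "z \<in># M" "C \<in> ?F" for z C
    proof -
      have "fst z \<otimes>\<^bsub>G\<^esub> inv\<^bsub>G\<^esub> (snd z) \<in># A" using that(1) by (auto simp: A quotients_def)
      then have "fst z \<otimes>\<^bsub>G\<^esub> inv\<^bsub>G\<^esub> (snd z) \<in> H" using assms(6) by blast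
      \<comment> \<open>For h = b c^-1 in \<open>H\<close> one has H h c = H c, while h c =
        b.\<close>
      then have "H #>\<^bsub>G\<^esub> (fst z \<otimes>\<^bsub>G\<^esub> inv\<^bsub>G\<^esub> (snd z)) #>\<^bsub>G\<^esub> snd z = H #>\<^bsub>G\<^esub> snd z"
        using assms(3) H by (simp add: coset_join2 subsetD)
      then have "H #>\<^bsub>G\<^esub> fst z = H #>\<^bsub>G\<^esub> snd z"
        using carr[OF that(1)] H by (simp add: coset_mult_assoc m_assoc)
      moreover have "x \<in> C \<longleftrightarrow> C = H #>\<^bsub>G\<^esub> x" if "x \<in> carrier G" for x
      proof
        obtain g where "g \<in> carrier G" "C = H #>\<^bsub>G\<^esub> g"
          using \<open>C \<in> ?F\<close> by (auto simp: RCOSETS_def)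
        then show "C = H #>\<^bsub>G\<^esub> x" if "x \<in> C"
          using that assms(3) repr_independence by metis
        show "x \<in> C" if "C = H #>\<^bsub>G\<^esub> x"
          using that rcos_self[OF \<open>x \<in> carrier G\<close> assms(3)] by simp
      qed
      ultimately show ?thesis using carr[OF that(1)] by blast
    qed
    have N: "matching C (N C)" if "C \<in> ?F" for C
      unfolding N_def using M assms(2) same that F(1) by (intro matching_filter) auto
    have good: "size (quotients G (N C)) = card H \<and> finprod_mset ?K (quotients G (N C)) = \<one>\<^bsub>G\<^esub>"
      if C: "C \<in> ?F" for C
    proof -
      obtain g where g: "g \<in> carrier G" "C = (\<lambda>x. x \<otimes>\<^bsub>G\<^esub> g) ` H" using rep[OF C] by blast
      \<comment> \<open>\<open>?r\<close> carries the coset \<open>C\<close> to \<open>H\<close>,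
        where the abelian product condition applies; \<open>?l\<close> carries it back, so the
        quotients of \<open>N C\<close> are those of a matching of \<open>H\<close>.\<close>
      let ?r = "\<lambda>x. x \<otimes>\<^bsub>G\<^esub> inv\<^bsub>G\<^esub> g" and ?l = "\<lambda>x. x \<otimes>\<^bsub>G\<^esub> g"
      have cg: "x \<in> carrier G" if "x \<in> C" for x using that C F(1) by blast
      have "?r ` C = H" using H g by (force simp: image_image m_assoc)
      moreover have "inj_on ?r C" using cg g(1) by (auto simp: inj_on_def)
      ultimately have N': "matching H (image_mset (map_prod ?r ?r) (N C))"
        using matching_map[OF N[OF C]] by metis
      have "quotients ?K (image_mset (map_prod ?r ?r) (N C)) =
        quotients G (image_mset (map_prod ?l ?l) (image_mset (map_prod ?r ?r) (N C)))"
        using matchingD(2,3)[OF N' finH] assms g(1) by (intro quotients_translate[symmetric]) auto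
      also have "image_mset (map_prod ?l ?l) (image_mset (map_prod ?r ?r) (N C)) = image_mset id (N C)"
        unfolding image_mset.compositionality
        by (rule image_mset_cong)
          (use matchingD(2,3)[OF N[OF C] finC[OF C]] cg g(1) in \<open>auto simp: m_assoc prod_eq_iff\<close>)
      finally have "finprod_mset ?K (quotients G (N C)) = \<one>\<^bsub>G\<^esub>"
        using K.finprod_mset_quotients_matching[of "image_mset (map_prod ?r ?r) (N C)"] N' finH by simp
      then show ?thesis
        using matchingD(1)[OF N' finH] by simp
    qed
    have "A = (\<Sum>C\<in>?F. quotients G (N C))"
      using sum_filter_mset[of ?F M fst] F carr by (simp add: A N_def quotients_sum[symmetric])
    also have "\<dots> = (\<Sum>j\<in>{1..card ?F}. quotients G (N (e j)))"
      by (rule sum.reindex_bij_betw[OF e, symmetric])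
    finally show "\<exists>P. A = (\<Sum>j\<in>{1..card ?F}. P j) \<and>
        (\<forall>j\<in>{1..card ?F}. size (P j) = card H \<and> finprod_mset ?K (P j) = \<one>\<^bsub>G\<^esub>)"
      using good bij_betwE[OF e] by (intro exI[of _ "\<lambda>j. quotients G (N (e j))"]) blast
  next
    assume "\<exists>P. A = (\<Sum>j\<in>{1..card ?F}. P j) \<and>
        (\<forall>j\<in>{1..card ?F}. size (P j) = card H \<and> finprod_mset ?K (P j) = \<one>\<^bsub>G\<^esub>)"
    then obtain P where A: "A = (\<Sum>j\<in>{1..card ?F}. P j)"
      and P: "\<And>j. j \<in> {1..card ?F} \<Longrightarrow> size (P j) = card H \<and> finprod_mset ?K (P j) = \<one>\<^bsub>G\<^esub>"
      by blast
    have "\<exists>M. matching (e j) M \<and> quotients G M = P j" if j: "j \<in> {1..card ?F}" for j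
    proof -
      have "set_mset (P j) \<subseteq> H"
        using j assms(6) by (force simp: A set_mset_sum)
      \<comment> \<open>Hall's theorem realizes \<open>P j\<close> inside \<open>H\<close>; right
        translation then moves the matching to the coset \<open>e j\<close>.\<close>
      then obtain M where M: "matching H M" "quotients ?K M = P j"
        using K.hall_matching[of "P j"] P[OF j] finH by (auto simp: order_def)
      have "e j \<in> ?F" using e j by (auto dest: bij_betwE)
      then obtain g where g: "g \<in> carrier G" "e j = (\<lambda>x. x \<otimes>\<^bsub>G\<^esub> g) ` H"
        using rep by blast
      show ?thesis
        using matching_map[OF M(1) inj[OF g(1)]] quotients_translate[OF assms(1,3) g(1), of M]
          matchingD(2,3)[OF M(1) finH] M(2) g(2) by metis
    qed
    then obtain M where M: "\<And>j. j \<in> {1..card ?F} \<Longrightarrow> matching (e j) (M j)"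
      "\<And>j. j \<in> {1..card ?F} \<Longrightarrow> quotients G (M j) = P j" by metis
    \<comment> \<open>The cosets are disjoint and cover the group, so the matchings of the single
      cosets add up to one of the whole group.\<close>
    have "(\<Sum>j\<in>{1..card ?F}. mset_set (e j)) = mset_set (carrier G)"
      using sum.reindex_bij_betw[OF e, of mset_set] sum_mset_set_disjoint[of ?F] F finC by simp
    then have "matching (carrier G) (\<Sum>j\<in>{1..card ?F}. M j)"
      using M(1) by (simp add: matching_def image_mset_sum)
    moreover have "quotients G (\<Sum>j\<in>{1..card ?F}. M j) = A"
      using M(2) by (simp add: quotients_sum A)
    ultimately show "quotient_realizable G A"
      using quotient_realizable_iff_matching[OF assms(2)] by blast
  qed
qed

end
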